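(* Let $T_n=\frac{1}{n+1}\binom{3n+1}{n}$ for $n\ge 0$, and let $Z_{3,m}(y)$ be the zero-run enumerator of $T_n\bmod 3$ on $0\le n<3^m$. For every $m\ge1$, $$Z_{3,m}(y)=\sum_{i=1}^{m-1}y^{(3^i-1)/2}+\sum_{j=2}^{m}(m-j+1)\,y^{3^{j-1}-1}.$$
   Context: For a prime $p$ and $m\ge1$, the zero-run enumerator is $Z_{p,m}(y)=\sum_R y^{|R|}$, where the sum runs over all maximal (nonempty) zero runs $R$ in the finite word $T_0,T_1,\ldots,T_{p^m-1}\pmod p$ (i.e. maximal intervals of consecutive indices in $[0,p^m-1]$ on which $T_n\equiv0\pmod p$) and $|R|$ is the length of $R$; a zero run meeting the right endpoint $p^m-1$ is counted with its truncated length inside this interval. Empty sums are $0$. *)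

theory Defs
  imports
    "HOL-Computational_Algebra.Polynomial"
    "HOL-Number_Theory.Cong"
begin

text \<open>The division in \<open>T n\<close> is exact, see \<open>T_exact\<close> and \<open>of_nat_T\<close> below.\<close>

definition T :: "nat \<Rightarrow> nat" where
  "T n = ((3 * n + 1) choose n) div (n + 1)"

lemma T_exact: "(n + 1) dvd ((3 * n + 1) choose n)"
proof -
  have "((3 * n + 1) choose (n + 1)) * (n + 1) = ((3 * n + 1) choose n) * (2 * n + 1)"
    using binomial_absorb_comp[of "3 * n + 1" n] binomial_absorption[of n "3 * n + 1"]
    by (simp add: mult.commute del: binomial_Suc_Suc mult_Suc mult_Suc_right)
  hence "(n + 1) dvd ((3 * n + 1) choose n) * (2 * n + 1)"
    by (metis dvd_triv_right)
  moreover have "coprime (n + 1) (2 * n + 1)"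
  proof (rule coprimeI)
    fix d assume "d dvd n + 1" "d dvd 2 * n + 1"
    hence "d dvd 2 * (n + 1) - (2 * n + 1)"
      by (intro dvd_diff_nat dvd_mult)
    thus "is_unit d" by simp
  qed
  ultimately show ?thesis
    using coprime_dvd_mult_left_iff by blast
qed

lemma of_nat_T: "(of_nat (T n) :: rat) = 1 / of_nat (n + 1) * of_nat ((3 * n + 1) choose n)"
proof -
  obtain k where k: "((3 * n + 1) choose n) = (n + 1) * k"
    using T_exact[of n] by (elim dvdE)
  hence "T n = k"
    unfolding T_def by (metis add_is_0 nonzero_mult_div_cancel_left one_neq_zero)
  thus ?thesis
    unfolding k of_nat_mult by (simp del: of_nat_add of_nat_Suc)
qed

definition zero_interval :: "nat \<Rightarrow> nat \<Rightarrow> nat set \<Rightarrow> bool" where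
  "zero_interval p m R \<longleftrightarrow>
     (\<exists>a b. a \<le> b \<and> b \<le> p ^ m - 1 \<and> R = {a..b}) \<and> (\<forall>n\<in>R. [T n = 0] (mod p))"

text \<open>Maximality is with respect to inclusion among intervals inside \<open>{0..p ^ m - 1}\<close>, so a run
  reaching the right endpoint \<open>p ^ m - 1\<close> is truncated there.\<close>

definition zero_run :: "nat \<Rightarrow> nat \<Rightarrow> nat set \<Rightarrow> bool" where
  "zero_run p m R \<longleftrightarrow>
     zero_interval p m R \<and> (\<forall>S. zero_interval p m S \<longrightarrow> R \<subseteq> S \<longrightarrow> S = R)"

lemma finite_zero_runs: "finite {R. zero_run p m R}"
  by (rule finite_subset[of _ "Pow {0..p ^ m - 1}"])
     (auto simp: zero_run_def zero_interval_def)

text \<open>The enumerator is a polynomial in the indeterminate \<open>y\<close>; \<open>monom c k\<close> stands for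
  \<open>c y\<^sup>k\<close>.\<close>

definition Z :: "nat \<Rightarrow> nat \<Rightarrow> int poly" where
  "Z p m = (\<Sum>R | zero_run p m R. monom 1 (card R))"

end

theory Submission
  imports Defs
begin

text \<open>Since \<open>(3n + 2) T\<^sub>n = 2 binom(3n + 2, n)\<close>, Lucas' congruence gives a recursion for the
  vanishing of \<open>T\<^sub>n\<close> modulo 3 on ternary digits: \<open>T\<^sub>n\<close> is nonzero modulo 3 iff the digits of \<open>n\<close>,
  read from the top, form a word \<open>1\<dots>12\<dots>2\<close> (either block may be empty), that is, iff
  \<open>2(n + 1) = 3\<^sup>i + 3\<^sup>j\<close> for some \<open>i \<le> j\<close>. The zero runs are the gaps between consecutive numbers
  of this form; the successor of the one for \<open>(i, j)\<close> is that for \<open>(i + 1, j)\<close> if \<open>i < j\<close>, and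
  for \<open>(0, j + 1)\<close> if \<open>i = j\<close>.\<close>

section \<open>Lucas' congruence modulo 3\<close>

text \<open>Compare coefficients in (1 + x)^(n+3) = (1 + x)^n (1 + x)^3, where (1 + x)^3 is
  congruent to 1 + x^3 modulo 3.\<close>

lemma choose_add_3_cong:
  fixes n k :: nat
  shows "[(n + 3) choose (k + 3) = (n choose (k + 3)) + (n choose k)] (mod 3)"
proof -
  have "(n + 3) choose (k + 3) = (n choose (k + 3)) + (n choose k)
      + 3 * ((n choose Suc k) + (n choose Suc (Suc k)))"
    by (simp add: numeral_3_eq_3)
  thus ?thesis by (metis cong_add_lcancel_0_nat cong_mult_self_left)
qed

lemma choose_add_3_cong_small:
  fixes n k :: nat
  assumes "k < 3"
  shows "[(n + 3) choose k = n choose k] (mod 3)"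
proof -
  from assms consider "k = 0" | "k = 1" | "k = 2" by linarith
  thus ?thesis
  proof cases
    case 3
    have "(n + 3) choose 2 = (n choose 2) + 3 * (n + 1)"
      by (simp add: numeral_3_eq_3 numeral_2_eq_2)
    thus ?thesis using 3 by (metis cong_add_lcancel_0_nat cong_mult_self_left)
  qed (auto simp: cong_def)
qed

text \<open>The one-digit form of Lucas' theorem. Raising \<open>a\<close> by one raises the upper
  index by 3, so the two preceding congruences turn the left side into Pascal's rule for
  \<open>a choose b\<close>.\<close>

lemma lucas_3:
  fixes a b r s :: nat
  assumes "r < 3" "s < 3"
  shows "[(3 * a + r) choose (3 * b + s) = (a choose b) * (r choose s)] (mod 3)"
proof (induction a arbitrary: b)
  case 0
  show ?case using assms by (cases b) (simp_all add: binomial_eq_0)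
next
  case (Suc a)
  show ?case
  proof (cases b)
    case 0
    have "[(3 * a + r + 3) choose s = (3 * a + r) choose s] (mod 3)"
      using assms(2) by (rule choose_add_3_cong_small)
    also have "[(3 * a + r) choose s = (a choose 0) * (r choose s)] (mod 3)"
      using Suc[of 0] by simp
    finally show ?thesis using 0 by (simp add: ac_simps)
  next
    case (Suc b')
    have "[(3 * a + r + 3) choose (3 * b' + s + 3) =
        ((3 * a + r) choose (3 * b' + s + 3)) + ((3 * a + r) choose (3 * b' + s))] (mod 3)"
      by (rule choose_add_3_cong)
    also have "[((3 * a + r) choose (3 * b' + s + 3)) + ((3 * a + r) choose (3 * b' + s)) =
        (a choose Suc b') * (r choose s) + (a choose b') * (r choose s)] (mod 3)"
      using Suc.IH[of "Suc b'"] Suc.IH[of b'] by (intro cong_add) (simp_all add: ac_simps)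
    finally show ?thesis
      using \<open>b = Suc b'\<close> by (simp add: algebra_simps)
  qed
qed

lemma three_dvd_choose_iff:
  fixes a b r s :: nat
  assumes "r < 3" "s < 3"
  shows "3 dvd ((3 * a + r) choose (3 * b + s)) \<longleftrightarrow> 3 dvd (a choose b) \<or> r < s"
proof -
  have "3 dvd ((3 * a + r) choose (3 * b + s)) \<longleftrightarrow> 3 dvd (a choose b) * (r choose s)"
    using lucas_3[OF assms] by (rule cong_dvd_iff)
  moreover have "prime (3 :: nat)" by simp
  moreover have "3 dvd (r choose s) \<longleftrightarrow> r < s"
  proof -
    have "r = 0 \<or> r = 1 \<or> r = 2" "s = 0 \<or> s = 1 \<or> s = 2" using assms by linarith+
    thus ?thesis by (auto simp: numeral_2_eq_2 binomial_eq_0)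
  qed
  ultimately show ?thesis by (metis prime_dvd_mult_iff)
qed

section \<open>Vanishing of \<open>T n\<close> modulo 3 in terms of ternary digits\<close>

text \<open>The upper index now ends in the ternary digit 2, which no last digit of \<open>n\<close>
  exceeds, and the factors \<open>3 * n + 2\<close> and 2 are prime to 3. Hence Lucas' congruence
  just strips the last digits.\<close>

lemma T_times: "(3 * n + 2) * T n = 2 * ((3 * n + 2) choose n)"
proof -
  define C where "C = ((3 * n + 1) choose n)"
  have 1: "(n + 1) * T n = C"
    using T_exact[of n] unfolding T_def C_def by (rule dvd_mult_div_cancel)
  have 2: "(2 * n + 2) * ((3 * n + 2) choose n) = (3 * n + 2) * C"
    using binomial_absorb_comp[of "3 * n + 2" n] by (simp add: C_def)
  have "(n + 1) * ((3 * n + 2) * T n) = (3 * n + 2) * ((n + 1) * T n)"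
    by (rule mult.left_commute)
  also have "\<dots> = (2 * n + 2) * ((3 * n + 2) choose n)"
    using 1 2 by simp
  also have "\<dots> = (n + 1) * (2 * ((3 * n + 2) choose n))"
    by (simp only: distrib_right distrib_left mult_ac mult_1)
  finally show ?thesis
    by (simp only: mult_cancel1) simp
qed

lemma three_dvd_T_iff: "3 dvd T n \<longleftrightarrow> 3 dvd (n choose (n div 3))"
proof -
  have co: "coprime 3 (3 * n + 2)" "coprime 3 (2::nat)"
  proof -
    have "prime (3::nat)" "\<not> 3 dvd 3 * n + 2" "\<not> 3 dvd (2::nat)" by (simp, presburger+)
    thus "coprime 3 (3 * n + 2)" "coprime 3 (2::nat)" using prime_imp_coprime by blast+
  qed
  have "3 dvd T n \<longleftrightarrow> 3 dvd (3 * n + 2) * T n"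
    using co(1) by (rule coprime_dvd_mult_right_iff[symmetric])
  also have "\<dots> \<longleftrightarrow> 3 dvd ((3 * n + 2) choose n)"
    unfolding T_times using co(2) by (rule coprime_dvd_mult_right_iff)
  also have "\<dots> \<longleftrightarrow> 3 dvd ((3 * n + 2) choose (3 * (n div 3) + n mod 3))"
    by simp
  also have "\<dots> \<longleftrightarrow> 3 dvd (n choose (n div 3))"
    by (subst three_dvd_choose_iff) auto
  finally show ?thesis .
qed

text \<open>A second use of Lucas, on \<open>(3 * q + r) choose q\<close>, compares the last digits
  of \<open>n\<close> and \<open>q\<close> and leaves the criterion for \<open>T q\<close>. Thus
  \<open>T n\<close> is nonzero modulo 3 iff the digits never decrease from the top.\<close>

lemma three_dvd_T_rec:
  assumes "r < 3"
  shows "3 dvd T (3 * q + r) \<longleftrightarrow> 3 dvd T q \<or> r < q mod 3"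
proof -
  have "(3 * q + r) div 3 = q" using assms by simp
  hence "3 dvd T (3 * q + r) \<longleftrightarrow> 3 dvd ((3 * q + r) choose q)"
    by (simp only: three_dvd_T_iff)
  also have "\<dots> \<longleftrightarrow> 3 dvd ((3 * q + r) choose (3 * (q div 3) + q mod 3))"
    by simp
  also have "\<dots> \<longleftrightarrow> 3 dvd (q choose (q div 3)) \<or> r < q mod 3"
    using assms by (subst three_dvd_choose_iff) auto
  finally show ?thesis by (simp only: three_dvd_T_iff)
qed

text \<open>The equation says n = (3^i - 1)/2 + (3^j - 1)/2, a sum of two blocks of ones:
  \<open>j - i\<close> digits 1 followed by \<open>i\<close> digits 2. The induction removes the
  last digit.\<close>

lemma not_three_dvd_T_iff:
  "\<not> 3 dvd T n \<longleftrightarrow> (\<exists>i j. i \<le> j \<and> 2 * (n + 1) = 3 ^ i + 3 ^ j)"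
proof (induction n rule: less_induct)
  case (less n)
  define q r where "q = n div 3" and "r = n mod 3"
  have n: "n = 3 * q + r" and r: "r < 3" by (simp_all add: q_def r_def)
  show ?case
  proof (cases "n = 0")
    case True
    have "2 * (0 + 1) = (3::nat) ^ 0 + 3 ^ 0" by simp
    thus ?thesis using True by (metis T_def binomial_n_0 le_refl mult_0_right add_0 div_by_1
      nat_dvd_1_iff_1 numeral_eq_one_iff semiring_norm(86))
  next
    case False
    hence "q < n" by (simp add: q_def)
    note IH = less.IH[OF this]
    show ?thesis
    proof
      assume "\<not> 3 dvd T n"
      hence "\<not> 3 dvd T q" and qr: "q mod 3 \<le> r"
        using three_dvd_T_rec[OF r, of q] n by auto
      then obtain i j where ij: "i \<le> j" "2 * (q + 1) = 3 ^ i + 3 ^ j" using IH by auto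
      \<comment> \<open>Appending the digit 2 is always allowed and raises both exponents by
        one.\<close>
      have r2: ?thesis if "r = 2"
      proof -
        have "2 * (n + 1) = 3 ^ Suc i + 3 ^ Suc j" using ij that n by simp
        thus ?thesis using ij(1) \<open>\<not> 3 dvd T n\<close> by (meson Suc_le_mono)
      qed
      show "\<exists>i j. i \<le> j \<and> 2 * (n + 1) = 3 ^ i + 3 ^ j"
      proof (cases "r = 2")
        case True
        thus ?thesis using r2 \<open>\<not> 3 dvd T n\<close> by blast
      next
        case r_ne: False
        \<comment> \<open>For \<open>i > 0\<close> the number \<open>q\<close> ends in 2, which
          would force \<open>r = 2\<close>.\<close>
        have i: "i = 0"
        proof (rule ccontr)
          assume "i \<noteq> 0"
          then obtain i' j' where "i = Suc i'" "j = Suc j'" using ij(1) by (metis Suc_le_D not0_implies_Suc)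
          hence "2 * (q + 1) = 3 * (3 ^ i' + 3 ^ j')" using ij by simp
          hence "q mod 3 = 2" by presburger
          thus False using qr r r_ne by linarith
        qed
        \<comment> \<open>If \<open>j = 0\<close> then \<open>q = 0\<close>, and
          \<open>r = n\<close> is nonzero; otherwise \<open>q\<close> ends in 1, so \<open>r\<close>
          is at least 1.\<close>
        have "r = 1"
        proof (cases j)
          case 0
          thus ?thesis using i ij n False r r_ne by simp
        next
          case (Suc j')
          hence "2 * (q + 1) = 3 * 3 ^ j' + 1" using ij i by simp
          hence "q mod 3 = 1" by presburger
          thus ?thesis using qr r r_ne by linarith
        qed
        hence "2 * (n + 1) = 3 ^ 0 + 3 ^ Suc j" using i ij n by simp
        thus ?thesis by blast
      qed
    next
      assume "\<exists>i j. i \<le> j \<and> 2 * (n + 1) = 3 ^ i + 3 ^ j"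
      then obtain i j where ij: "i \<le> j" "2 * (n + 1) = 3 ^ i + 3 ^ j" by blast
      \<comment> \<open>With \<open>j = 0\<close> the equation would give
        \<open>n = 0\<close>.\<close>
      obtain j' where j': "j = Suc j'" using ij False by (cases j) auto
      have "\<not> 3 dvd T q \<and> q mod 3 \<le> r"
      proof (cases i)
        case 0
        hence eq: "2 * (n + 1) = 3 * 3 ^ j' + 1" using ij j' by simp
        hence r1: "r = 1" unfolding r_def by presburger
        hence q: "2 * (q + 1) = 3 ^ 0 + 3 ^ j'" using eq n by simp
        have "q mod 3 \<le> 1"
        proof (cases j')
          case (Suc k)
          hence "2 * (q + 1) = 3 * 3 ^ k + 1" using q by simp
          thus ?thesis by presburger
        qed (use q in simp)
        thus ?thesis using q IH r1 by blast
      next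
        case (Suc i')
        hence eq: "2 * (n + 1) = 3 * (3 ^ i' + 3 ^ j')" using ij j' by simp
        hence r2: "r = 2" unfolding r_def by presburger
        hence q: "2 * (q + 1) = 3 ^ i' + 3 ^ j'" using eq n by simp
        have "q mod 3 < 3" by simp
        thus ?thesis using q IH r2 Suc j' ij(1) by (metis Suc_le_mono less_Suc_eq_le numeral_3_eq_3 numeral_2_eq_2)
      qed
      thus "\<not> 3 dvd T n" using three_dvd_T_rec[OF r, of q] n by simp
    qed
  qed
qed

section \<open>The nonzero positions in increasing order\<close>

text \<open>For \<open>i \<le> j\<close> this is the number with \<open>j\<close> ternary digits of
  which the last \<open>i\<close> are 2 and the others 1.\<close>

definition supp :: "nat \<times> nat \<Rightarrow> nat" where
  "supp = (\<lambda>(i, j). (3 ^ i + 3 ^ j) div 2 - 1)"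

fun succ_index :: "nat \<times> nat \<Rightarrow> nat \<times> nat" where
  "succ_index (i, j) = (if i < j then (Suc i, j) else (0, Suc j))"

lemma supp_eq: "2 * (supp (i, j) + 1) = 3 ^ i + 3 ^ j"
proof -
  have "even ((3::nat) ^ i + 3 ^ j)" by simp
  moreover have "(3::nat) ^ i + 3 ^ j \<ge> 2"
    using one_le_power[of "3::nat" i] one_le_power[of "3::nat" j] by linarith
  ultimately show ?thesis unfolding supp_def by (auto elim!: evenE)
qed

lemma not_three_dvd_T_supp_iff: "\<not> 3 dvd T n \<longleftrightarrow> (\<exists>i j. i \<le> j \<and> n = supp (i, j))"
  unfolding not_three_dvd_T_iff using supp_eq by (metis add_right_cancel mult_left_cancel zero_neq_numeral)

text \<open>The order is lexicographic with \<open>j\<close> first: 3^k + 3^l is at most 2 * 3^l,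
  which is below 3^(l+1).\<close>

lemma supp_less:
  assumes "k \<le> l" "i \<le> j" "l < j \<or> l = j \<and> k < i"
  shows "supp (k, l) < supp (i, j)"
proof -
  have "(3::nat) ^ k + 3 ^ l < 3 ^ i + 3 ^ j"
  proof (cases "l < j")
    case True
    have "(3::nat) ^ k \<le> 3 ^ l" using assms by simp
    moreover have "(3::nat) ^ Suc l \<le> 3 ^ j" using True by (intro power_increasing) auto
    moreover have "(0::nat) < 3 ^ i" by simp
    ultimately show ?thesis unfolding power_Suc by linarith
  next
    case False
    thus ?thesis using assms by simp
  qed
  hence "2 * (supp (k, l) + 1) < 2 * (supp (i, j) + 1)" unfolding supp_eq .
  thus ?thesis by simp
qed

lemma supp_inject:
  assumes "k \<le> l" "i \<le> j" "supp (k, l) = supp (i, j)"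
  shows "k = i \<and> l = j"
  using supp_less[OF assms(1,2)] supp_less[OF assms(2,1)] assms(3)
  by (metis linorder_less_linear less_irrefl)

lemma succ_index_le: "i \<le> j \<Longrightarrow> fst (succ_index (i, j)) \<le> snd (succ_index (i, j))"
  by auto

lemma supp_succ_index_less: "i \<le> j \<Longrightarrow> supp (i, j) < supp (succ_index (i, j))"
  by (auto intro!: supp_less)

text \<open>No nonzero position lies strictly between two consecutive ones, since
  \<open>succ_index\<close> is the immediate successor in the lexicographic order.\<close>

lemma supp_succ_index_least:
  assumes "i \<le> j" "\<not> 3 dvd T n" "supp (i, j) < n"
  shows "supp (succ_index (i, j)) \<le> n"
proof -
  obtain k l where kl: "k \<le> l" "n = supp (k, l)"
    using assms(2) not_three_dvd_T_supp_iff by blast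
  have "\<not> (l < j \<or> l = j \<and> k \<le> i)"
    using supp_less[OF kl(1) assms(1)] assms(3) kl(2) by (metis le_neq_implies_less less_asym')
  hence "succ_index (i, j) = (k, l) \<or> snd (succ_index (i, j)) < l
      \<or> snd (succ_index (i, j)) = l \<and> fst (succ_index (i, j)) < k"
    using kl(1) assms(1) by auto
  thus ?thesis
    using supp_less[OF succ_index_le[OF assms(1)] kl(1)] kl(2)
    by (metis le_less prod.collapse)
qed

section \<open>Zero runs as gaps between nonzero positions\<close>

text \<open>With nonzero values at both ends of the word no run touches an end, so none is truncated
  and each is bounded on both sides by nonzero positions.\<close>

lemma zero_run_iff:
  assumes "\<not> p dvd T 0" "\<not> p dvd T (p ^ m - 1)"
  shows "zero_run p m R \<longleftrightarrow>
    (\<exists>a b. a + 1 < b \<and> b \<le> p ^ m - 1 \<and> \<not> p dvd T a \<and> \<not> p dvd T b \<and>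
      R = {a<..<b} \<and> (\<forall>n\<in>R. p dvd T n))"
proof
  assume run: "zero_run p m R"
  then obtain c d where cd: "c \<le> d" "d \<le> p ^ m - 1" "R = {c..d}" and R: "\<forall>n\<in>R. p dvd T n"
    by (auto simp: zero_run_def zero_interval_def cong_0_iff)
  have max: "S = R" if "zero_interval p m S" "R \<subseteq> S" for S
    using run that by (auto simp: zero_run_def)
  have "p dvd T c" "p dvd T d" using R cd by auto
  hence c: "c \<noteq> 0" and d: "d \<noteq> p ^ m - 1" using assms by metis+
  have "\<not> p dvd T (c - 1)"
  proof
    assume z: "p dvd T (c - 1)"
    have "p dvd T n" if "n \<in> {c - 1..d}" for n
      using that z R cd(3) by (cases "n = c - 1") auto
    hence "zero_interval p m {c - 1..d}"
      using cd unfolding zero_interval_def cong_0_iff by (metis diff_le_self le_trans)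
    hence "{c - 1..d} = R" by (rule max) (use cd in auto)
    hence "c - 1 \<in> {c..d}" using cd by (metis atLeastAtMost_iff diff_le_self le_refl le_trans)
    hence "c \<le> c - 1" by simp
    thus False using c by linarith
  qed
  moreover have "\<not> p dvd T (d + 1)"
  proof
    assume z: "p dvd T (d + 1)"
    have "p dvd T n" if "n \<in> {c..d + 1}" for n
      using that z R cd(3) by (cases "n = d + 1") auto
    moreover have "c \<le> d + 1" "d + 1 \<le> p ^ m - 1" using cd d by auto
    ultimately have "zero_interval p m {c..d + 1}"
      unfolding zero_interval_def cong_0_iff by blast
    hence "{c..d + 1} = R" by (rule max) (use cd in auto)
    hence "d + 1 \<in> {c..d}" using cd by (metis atLeastAtMost_iff le_refl trans_le_add1)
    thus False by simp
  qed
  moreover have "R = {c - 1<..<d + 1}" using c cd by auto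
  moreover have "c - 1 + 1 < d + 1" "d + 1 \<le> p ^ m - 1" using c d cd by auto
  ultimately show "\<exists>a b. a + 1 < b \<and> b \<le> p ^ m - 1 \<and> \<not> p dvd T a \<and> \<not> p dvd T b \<and>
      R = {a<..<b} \<and> (\<forall>n\<in>R. p dvd T n)"
    using R by blast
next
  assume "\<exists>a b. a + 1 < b \<and> b \<le> p ^ m - 1 \<and> \<not> p dvd T a \<and> \<not> p dvd T b \<and>
      R = {a<..<b} \<and> (\<forall>n\<in>R. p dvd T n)"
  then obtain a b where ab: "a + 1 < b" "b \<le> p ^ m - 1" "\<not> p dvd T a" "\<not> p dvd T b"
      "R = {a<..<b}" and R: "\<forall>n\<in>R. p dvd T n"
    by blast
  have "R = {a + 1..b - 1}" "a + 1 \<le> b - 1" "b - 1 \<le> p ^ m - 1" using ab by auto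
  hence "zero_interval p m R" using R unfolding zero_interval_def cong_0_iff by blast
  \<comment> \<open>An interval containing \<open>R\<close> but avoiding both neighbours
    \<open>a\<close> and \<open>b\<close> cannot be larger.\<close>
  moreover have "S = R" if S: "zero_interval p m S" "R \<subseteq> S" for S
  proof -
    obtain c d where cd: "S = {c..d}" and z: "\<forall>n\<in>S. p dvd T n"
      using S by (auto simp: zero_interval_def cong_0_iff)
    have "a \<notin> S" "b \<notin> S" using z ab by auto
    moreover have "c \<le> a + 1" "b - 1 \<le> d" using S(2) ab cd by (auto simp: subset_iff)
    ultimately show ?thesis using ab cd by auto
  qed
  ultimately show "zero_run p m R" by (simp add: zero_run_def)
qed

definition gap :: "nat \<times> nat \<Rightarrow> nat set" where
  "gap x = {supp x<..<supp (succ_index x)}"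

text \<open>Twice the distance of the endpoints is 3^(i+1) - 3^i = 2 * 3^i if \<open>i < j\<close>,
  and 1 + 3^(j+1) - 2 * 3^j = 3^j + 1 if \<open>i = j\<close>. The open interval has one element
  less than the distance.\<close>

lemma card_gap:
  assumes "i \<le> j"
  shows "card (gap (i, j)) = (if i < j then 3 ^ i - 1 else (3 ^ j - 1) div 2)"
proof (cases "i < j")
  case True
  thus ?thesis using supp_eq[of i j] supp_eq[of "Suc i" j] by (simp add: gap_def)
next
  case False
  thus ?thesis using assms supp_eq[of j j] supp_eq[of 0 "Suc j"] by (simp add: gap_def)
qed

lemma gap_nonempty:
  assumes "1 \<le> i" "i \<le> j"
  shows "supp (i, j) + 1 < supp (succ_index (i, j))"
proof -
  have "(3::nat) ^ 1 \<le> 3 ^ i" "(3::nat) ^ 1 \<le> 3 ^ j"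
    using assms by (intro power_increasing; simp)+
  hence "card (gap (i, j)) \<noteq> 0" using assms by (simp add: card_gap)
  thus ?thesis by (simp add: gap_def)
qed

text \<open>A nonempty gap determines its left endpoint through its minimum, and \<open>supp\<close>
  is injective. Gaps with \<open>i = 0\<close> are all empty, hence the bound on
  \<open>i\<close>.\<close>

lemma inj_on_gap: "inj_on gap {(i, j). 1 \<le> i \<and> i \<le> j}"
proof (rule inj_onI; clarsimp)
  fix i j k l :: nat
  assume h: "Suc 0 \<le> i" "i \<le> j" "Suc 0 \<le> k" "k \<le> l" and eq: "gap (i, j) = gap (k, l)"
  have "Min {a<..<b} = a + 1" if "a + 1 < b" for a b :: nat
    using that by (intro Min_eqI) auto
  hence "supp (i, j) + 1 = supp (k, l) + 1"
    using eq gap_nonempty[of i j] gap_nonempty[of k l] h unfolding gap_def One_nat_def by metis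
  thus "i = k \<and> j = l" using supp_inject[OF h(2,4)] by simp
qed

text \<open>The right endpoint \<open>3 ^ m - 1\<close> is itself \<open>supp (m, m)\<close>, the
  last position whose second index is \<open>m\<close>.\<close>

lemma supp_le_iff:
  assumes "i \<le> j"
  shows "supp (i, j) \<le> 3 ^ m - 1 \<longleftrightarrow> j \<le> m"
proof -
  have m: "supp (m, m) = 3 ^ m - 1" by (simp add: supp_def)
  show ?thesis
  proof
    assume "supp (i, j) \<le> 3 ^ m - 1"
    thus "j \<le> m" using supp_less[of m m i j] assms m by linarith
  next
    assume "j \<le> m"
    hence "i = m \<and> j = m \<or> supp (i, j) < supp (m, m)"
      using assms supp_less[of i j m m] by linarith
    thus "supp (i, j) \<le> 3 ^ m - 1" using m by auto
  qed
qed

text \<open>The condition \<open>i < m\<close> removes only \<open>(m, m)\<close>, whose gap begins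
  at the right endpoint of the word.\<close>

lemma zero_runs_3:
  "{R. zero_run 3 m R} = gap ` {(i, j). 1 \<le> i \<and> i \<le> j \<and> j \<le> m \<and> i < m}"
proof -
  have nz: "\<not> 3 dvd T (supp (i, j))" if "i \<le> j" for i j
    using that not_three_dvd_T_supp_iff by blast
  have "supp (0, 0) = 0" "supp (m, m) = 3 ^ m - 1" by (simp_all add: supp_def)
  hence iff: "zero_run 3 m R \<longleftrightarrow>
    (\<exists>a b. a + 1 < b \<and> b \<le> 3 ^ m - 1 \<and> \<not> 3 dvd T a \<and> \<not> 3 dvd T b \<and>
      R = {a<..<b} \<and> (\<forall>n\<in>R. 3 dvd T n))" for R
    using nz[of 0 0] nz[of m m] by (intro zero_run_iff) simp_all
  have nz_succ: "\<not> 3 dvd T (supp (succ_index (i, j)))" if "i \<le> j" for i j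
    using nz[OF succ_index_le[OF that]] by simp
  \<comment> \<open>The successor has second index \<open>j\<close> if \<open>i < j\<close>, and
    \<open>Suc j\<close> if \<open>i = j\<close>; in the latter case \<open>i < m\<close> is the
    binding condition.\<close>
  have succ_le: "supp (succ_index (i, j)) \<le> 3 ^ m - 1 \<longleftrightarrow> j \<le> m \<and> i < m" if "i \<le> j" for i j
    using supp_le_iff[OF succ_index_le[OF that], of m] that by auto
  show ?thesis
  proof (intro equalityI subsetI)
    fix R assume "R \<in> {R. zero_run 3 m R}"
    then obtain a b where ab: "a + 1 < b" "b \<le> 3 ^ m - 1" "\<not> 3 dvd T a" "\<not> 3 dvd T b"
      "R = {a<..<b}" and R: "\<forall>n\<in>R. 3 dvd T n"
      unfolding mem_Collect_eq iff by blast
    obtain i j where ij: "i \<le> j" "a = supp (i, j)"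
      using ab(3) not_three_dvd_T_supp_iff by blast
    have "supp (succ_index (i, j)) \<le> b"
      using supp_succ_index_least[OF ij(1) ab(4)] ij ab by simp
    \<comment> \<open>Otherwise this nonzero position would lie inside the run
      \<open>R\<close>.\<close>
    moreover have "\<not> supp (succ_index (i, j)) < b"
      using R ab(5) nz_succ[OF ij(1)] supp_succ_index_less[OF ij(1)] ij(2) by auto
    ultimately have b: "b = supp (succ_index (i, j))" by simp
    have "1 \<le> i"
    proof (rule ccontr)
      assume "\<not> 1 \<le> i"
      hence "i = 0" by simp
      hence "card (gap (i, j)) = 0" using card_gap[OF ij(1)] by (cases "j = 0") simp_all
      thus False using ab(1) ij(2) b by (simp add: gap_def)
    qed
    hence "(i, j) \<in> {(i, j). 1 \<le> i \<and> i \<le> j \<and> j \<le> m \<and> i < m}"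
      using succ_le[OF ij(1)] ij(1) ab(2) b by simp
    moreover have "R = gap (i, j)" using ab(5) ij(2) b by (simp add: gap_def)
    ultimately show "R \<in> gap ` {(i, j). 1 \<le> i \<and> i \<le> j \<and> j \<le> m \<and> i < m}"
      by (rule rev_image_eqI)
  next
    fix R assume "R \<in> gap ` {(i, j). 1 \<le> i \<and> i \<le> j \<and> j \<le> m \<and> i < m}"
    then obtain i j where ij: "1 \<le> i" "i \<le> j" "j \<le> m" "i < m" "R = gap (i, j)" by auto
    have "3 dvd T n" if "n \<in> R" for n
      using supp_succ_index_least[OF ij(2), of n] that ij(5) by (auto simp: gap_def)
    hence "zero_run 3 m R"
      unfolding iff
      using gap_nonempty[OF ij(1,2)] succ_le[OF ij(2)] nz[OF ij(2)] nz_succ[OF ij(2)] ij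
      unfolding gap_def by blast
    thus "R \<in> {R. zero_run 3 m R}" by simp
  qed
qed

section \<open>Evaluation of the enumerator by summing over the gaps\<close>

theorem theorem4p5:
  fixes m :: nat
  assumes "m \<ge> 1"
  shows "Z 3 m = (\<Sum>i = 1..m - 1. monom 1 ((3 ^ i - 1) div 2))
               + (\<Sum>j = 2..m. monom (int (m - j + 1)) (3 ^ (j - 1) - 1))"
proof -
  let ?c = "\<lambda>x. monom (1::int) (card (gap x))"
  have "Z 3 m = sum ?c {(i, j). 1 \<le> i \<and> i \<le> j \<and> j \<le> m \<and> i < m}"
    unfolding Z_def zero_runs_3
    by (subst sum.reindex) (auto intro: inj_on_subset[OF inj_on_gap])
  also have "{(i, j). 1 \<le> i \<and> i \<le> j \<and> j \<le> m \<and> i < m} = (SIGMA i:{1..m - 1}. {i..m})"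
    by auto
  also have "sum ?c \<dots> = (\<Sum>i = 1..m - 1. \<Sum>j = i..m. ?c (i, j))"
    by (subst sum.Sigma) (simp_all add: case_prod_eta)
  also have "\<dots> = (\<Sum>i = 1..m - 1. monom 1 ((3 ^ i - 1) div 2) + monom (int (m - i)) (3 ^ i - 1))"
  proof (rule sum.cong[OF refl])
    \<comment> \<open>The diagonal term \<open>j = i\<close> gives the exponent
      \<open>(3 ^ i - 1) div 2\<close>; the \<open>m - i\<close> terms with \<open>j > i\<close> all
      have exponent \<open>3 ^ i - 1\<close>.\<close>
    fix i assume "i \<in> {1..m - 1}"
    hence "(\<Sum>j = i..m. ?c (i, j)) = ?c (i, i) + (\<Sum>j = Suc i..m. ?c (i, j))"
      by (intro sum.atLeast_Suc_atMost) auto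
    also have "(\<Sum>j = Suc i..m. ?c (i, j)) = (\<Sum>j = Suc i..m. monom 1 (3 ^ i - 1))"
      by (intro sum.cong) (auto simp: card_gap)
    also have "\<dots> = monom (int (m - i)) (3 ^ i - 1)"
      by (simp add: of_nat_monom mult_monom)
    finally show "(\<Sum>j = i..m. ?c (i, j))
        = monom 1 ((3 ^ i - 1) div 2) + monom (int (m - i)) (3 ^ i - 1)"
      by (simp add: card_gap)
  qed
  also have "\<dots> = (\<Sum>i = 1..m - 1. monom 1 ((3 ^ i - 1) div 2))
      + (\<Sum>i = 1..m - 1. monom (int (m - i)) (3 ^ i - 1))"
    by (rule sum.distrib)
  also have "(\<Sum>i = 1..m - 1. monom (int (m - i)) (3 ^ i - 1))
      = (\<Sum>j = 2..m. monom (int (m - j + 1)) (3 ^ (j - 1) - 1))"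
    by (rule sum.reindex_bij_witness[of _ "\<lambda>j. j - 1" "\<lambda>i. i + 1"]) auto
  finally show ?thesis .
qed

end
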